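(* Fix an integer $n\ge2$. The maximum length of a maximal chain in the cyclic Tamari lattice $\mathsf{CTam}=\mathsf{CTam}_{312}$ is $\binom{n+1}{2}$. The maximum length of a maximal chain in the affine Tamari lattice $\mathsf{ATam}=\mathsf{ATam}_{312}$ is $\binom{n+1}{2}-1$.
   Context: Fix an integer $n\ge 2$. A translation-invariant total order (TITO) is a total order $\preceq$ on $\mathbb Z$ such that $a\preceq b$ iff $a+n\preceq b+n$ for all $a,b\in\mathbb Z$. A reflection index is a pair $(a,b)$ of integers with $a<b$, considered up to simultaneous translation by multiples of $n$. An inversion of $\preceq$ is a reflection index $(a,b)$ with $b\preceq a$; $\mathrm{Inv}(\preceq)$ is the set of inversions. TITOs are ordered by $\preceq_1\,\le\,\preceq_2$ iff $\mathrm{Inv}(\preceq_1)\subseteq\mathrm{Inv}(\preceq_2)$. A TITO is $312$-avoiding if there are no integers $a<b<c$ with $c\preceq a\preceq b$. A block of a TITO is a nonempty order-convex subset $I\subseteq\mathbb Z$ with no minimal or maximal element in which all intervals between two elements are finite; its size is the number of residue classes modulo $n$ it contains; it is waxing if $x\preceq x+n$ for $x\in I$ and waning otherwise. A TITO is real if every block of size $1$ is waxing. $\mathsf{CTam}_{312}$ (resp. $\mathsf{ATam}_{312}$) is the poset of $312$-avoiding (resp. $312$-avoiding real) TITOs with the induced order; both are finite lattices. The length of a chain is one less than its number of elements. *)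

theory Defs
  imports Complex_Main "HOL-Number_Theory.Cong"
begin

text \<open>
  A total order on the integers is a relation \<open>r\<close>, where \<open>(a, b) \<in> r\<close> means \<open>a\<close> precedes or
  equals \<open>b\<close>. The symbols \<open><\<close> and \<open>\<le>\<close> on integers always denote the usual order.
\<close>

definition tito :: "nat \<Rightarrow> int rel \<Rightarrow> bool" where
  "tito n r \<longleftrightarrow> linear_order r \<and> (\<forall>a b. (a, b) \<in> r \<longleftrightarrow> (a + int n, b + int n) \<in> r)"

definition translation_rel :: "nat \<Rightarrow> (int \<times> int) rel" where
  "translation_rel n = {((a, b), (c, d)). a < b \<and> (\<exists>k. c = a + k * int n \<and> d = b + k * int n)}"

text \<open>
  A reflection index is an element of \<open>{(a, b). a < b} // translation_rel n\<close>; note that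
  \<open>a\<close> and \<open>b\<close> may be congruent modulo \<open>n\<close>.
\<close>

definition inversions :: "nat \<Rightarrow> int rel \<Rightarrow> (int \<times> int) set set" where
  "inversions n r = {(a, b). a < b \<and> (b, a) \<in> r} // translation_rel n"

definition tito_le :: "nat \<Rightarrow> int rel \<Rightarrow> int rel \<Rightarrow> bool" where
  "tito_le n r s \<longleftrightarrow> inversions n r \<subseteq> inversions n s"

definition avoids_312 :: "int rel \<Rightarrow> bool" where
  "avoids_312 r \<longleftrightarrow> \<not> (\<exists>a b c. a < b \<and> b < c \<and> (c, a) \<in> r \<and> (a, b) \<in> r)"

definition block :: "int rel \<Rightarrow> int set \<Rightarrow> bool" where
  "block r I \<longleftrightarrow> I \<noteq> {}
    \<and> (\<forall>a\<in>I. \<forall>b\<in>I. \<forall>x. (a, x) \<in> r \<and> (x, b) \<in> r \<longrightarrow> x \<in> I)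
    \<and> \<not> (\<exists>m\<in>I. \<forall>x\<in>I. (x, m) \<in> r \<longrightarrow> x = m)
    \<and> \<not> (\<exists>m\<in>I. \<forall>x\<in>I. (m, x) \<in> r \<longrightarrow> x = m)
    \<and> (\<forall>a\<in>I. \<forall>b\<in>I. finite {x. (a, x) \<in> r \<and> (x, b) \<in> r})"

definition block_size :: "nat \<Rightarrow> int set \<Rightarrow> nat" where
  "block_size n I = card {i \<in> {0..<int n}. {x. [x = i] (mod int n)} \<subseteq> I}"

definition waxing :: "nat \<Rightarrow> int rel \<Rightarrow> int set \<Rightarrow> bool" where
  "waxing n r I \<longleftrightarrow> (\<forall>x\<in>I. (x, x + int n) \<in> r)"

definition real_tito :: "nat \<Rightarrow> int rel \<Rightarrow> bool" where
  "real_tito n r \<longleftrightarrow> tito n r \<and> (\<forall>I. block r I \<and> block_size n I = 1 \<longrightarrow> waxing n r I)"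

definition CTam :: "nat \<Rightarrow> int rel set" where
  "CTam n = {r. tito n r \<and> avoids_312 r}"

definition ATam :: "nat \<Rightarrow> int rel set" where
  "ATam n = {r. real_tito n r \<and> avoids_312 r}"

definition chain_length :: "'a set \<Rightarrow> nat" where
  "chain_length C = card C - 1"

text \<open>
  Chains in the poset \<open>(P, le)\<close> are those of the library locale \<open>pred_on\<close>, which closes \<open>le\<close>
  reflexively. Finiteness is required explicitly because \<open>card\<close> of an infinite set is \<open>0\<close>.
\<close>

definition is_max_chain_length :: "'a set \<Rightarrow> ('a \<Rightarrow> 'a \<Rightarrow> bool) \<Rightarrow> nat \<Rightarrow> bool" where
  "is_max_chain_length P le L \<longleftrightarrow>
     (\<exists>C. pred_on.maxchain P le C \<and> finite C \<and> chain_length C = L)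
   \<and> (\<forall>C. pred_on.maxchain P le C \<longrightarrow> finite C \<and> chain_length C \<le> L)"

end

theory Submission
  imports Defs
begin

text \<open>
  Call \<open>(a, b)\<close> with \<open>a < b\<close> inverted when \<open>b\<close> precedes \<open>a\<close>. Avoiding \<open>312\<close> means exactly that,
  for each \<open>a\<close>, the integers \<open>b > a\<close> that precede \<open>a\<close> form an initial segment of
  \<open>a + 1, a + 2, \<dots>\<close>. So a \<open>312\<close>-avoiding TITO is encoded by the lengths of these segments, one for
  each residue class, as a Tamari lattice element is encoded by its bracket vector. A segment
  that reaches \<open>a + n\<close> is infinite, by translation. Each entry thus lies in
  \<open>{0, \<dots>, n - 1, \<infinity>}\<close>, and the value \<open>\<infinity>\<close> is written \<open>n\<close> below. Inclusion of inversion sets is the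
  componentwise order of the vectors (\<open>tito_le_iff_bracket_le\<close>), and the vectors that occur are
  those in which a finite segment starting after \<open>a\<close> contains the segment of each of its members
  (\<open>bracket_nested\<close>, \<open>order_of_CTam\<close>).

  Upper bound. The length of a chain is at most the number of pairs \<open>(a, v)\<close> such that the entry
  of the residue class \<open>a\<close> takes the nonzero value \<open>v\<close> somewhere in the chain. There are at most
  \<open>n\<close> such pairs with \<open>v = \<infinity>\<close>. A pair with finite \<open>v\<close> is charged to the two residue classes
  \<open>a\<close> and \<open>a + v\<close>. No two classes are charged twice: if \<open>a\<close> has reached \<open>a + v\<close>, then from
  that point of the chain on, \<open>a + v\<close> cannot reach exactly \<open>a + n\<close>, since nestedness would make
  the segment of \<open>a\<close> infinite, and then that of \<open>a + v\<close> too (\<open>no_opposite_values\<close>). The situation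
  is symmetric in the two classes, so it does not matter which value occurs first. This gives
  \<open>n + (n choose 2)\<close>, which is \<open>(n + 1) choose 2\<close>.

  Real orders. The integers with infinite segment form one waning block at the end of the order,
  so an element of \<open>CTam n\<close> is real iff its number of infinite entries is not \<open>1\<close>
  (\<open>real_iff_card_infinite\<close>). A chain of real orders must pass from no infinite entry to at least
  two in a single step, and this costs one unit of length.

  Sharpness. Let the entries of the classes \<open>0, 1, \<dots>, n - 1\<close> grow one after the other in unit
  steps, each entry \<open>a\<close> up to \<open>n - 1 - a\<close>, and then turn the entries into \<open>\<infinity>\<close> in the same
  order. Exactly one member of this chain has a single infinite entry, and leaving it
  out gives the chain of real orders.
\<close>

section \<open>Translation-invariant orders and their inversions\<close>

lemma tito_refl: "tito n r \<Longrightarrow> (a, a) \<in> r"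
  by (auto simp: tito_def linear_order_on_def partial_order_on_def preorder_on_def refl_on_def)

lemma tito_trans: "tito n r \<Longrightarrow> (a, b) \<in> r \<Longrightarrow> (b, c) \<in> r \<Longrightarrow> (a, c) \<in> r"
  unfolding tito_def linear_order_on_def partial_order_on_def preorder_on_def
  by (meson transD)

lemma tito_antisym: "tito n r \<Longrightarrow> (a, b) \<in> r \<Longrightarrow> (b, a) \<in> r \<Longrightarrow> a = b"
  unfolding tito_def linear_order_on_def partial_order_on_def
  by (meson antisymD)

lemma tito_total: "tito n r \<Longrightarrow> (a, b) \<in> r \<or> (b, a) \<in> r"
  using tito_refl[of n r a]
  unfolding tito_def linear_order_on_def total_on_def by (metis UNIV_I)

lemma tito_shift:
  assumes "tito n r"
  shows "(a + k * int n, b + k * int n) \<in> r \<longleftrightarrow> (a, b) \<in> r"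
proof -
  have step: "(a, b) \<in> r \<longleftrightarrow> (a + int n, b + int n) \<in> r" for a b
    using assms by (simp add: tito_def)
  have up: "(a + int j * int n, b + int j * int n) \<in> r \<longleftrightarrow> (a, b) \<in> r" for j :: nat and a b
  proof (induction j)
    case (Suc j)
    then show ?case
      using step[of "a + int j * int n" "b + int j * int n"] by (simp add: algebra_simps)
  qed simp
  show ?thesis
  proof (cases "0 \<le> k")
    case True
    then show ?thesis using up[of a "nat k" b] by simp
  next
    case False
    then show ?thesis
      using up[of "a + k * int n" "nat (-k)" "b + k * int n"] by simp
  qed
qed

lemma translation_class_in_inversions:
  assumes "tito n r" and "a < b"
  shows "translation_rel n `` {(a, b)} \<in> inversions n r \<longleftrightarrow> (b, a) \<in> r"
proof
  assume "translation_rel n `` {(a, b)} \<in> inversions n r"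
  then obtain c d where cd: "c < d" "(d, c) \<in> r"
    and eq: "translation_rel n `` {(a, b)} = translation_rel n `` {(c, d)}"
    unfolding inversions_def quotient_def by auto
  have "(a, b) \<in> translation_rel n `` {(a, b)}"
    using assms(2) unfolding translation_rel_def by (auto intro: exI[of _ 0])
  then obtain k where "a = c + k * int n" "b = d + k * int n"
    unfolding eq unfolding translation_rel_def by auto
  then show "(b, a) \<in> r" using cd tito_shift[OF assms(1)] by simp
next
  assume "(b, a) \<in> r"
  then show "translation_rel n `` {(a, b)} \<in> inversions n r"
    using assms(2) unfolding inversions_def by (auto intro: quotientI)
qed

lemma tito_le_iff:
  assumes "tito n r" and "tito n s"
  shows "tito_le n r s \<longleftrightarrow> (\<forall>a b. a < b \<longrightarrow> (b, a) \<in> r \<longrightarrow> (b, a) \<in> s)"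
proof
  assume "tito_le n r s"
  then show "\<forall>a b. a < b \<longrightarrow> (b, a) \<in> r \<longrightarrow> (b, a) \<in> s"
    using translation_class_in_inversions assms unfolding tito_le_def by blast
next
  assume "\<forall>a b. a < b \<longrightarrow> (b, a) \<in> r \<longrightarrow> (b, a) \<in> s"
  then have "{(a, b). a < b \<and> (b, a) \<in> r} \<subseteq> {(a, b). a < b \<and> (b, a) \<in> s}"
    by auto
  then show "tito_le n r s"
    unfolding tito_le_def inversions_def quotient_def by blast
qed

section \<open>Bracket vectors\<close>

text \<open>
  Counting only up to \<open>a + n\<close> replaces the value \<open>\<infinity>\<close> by \<open>n\<close> and keeps the entries natural numbers.
\<close>

definition bracket :: "nat \<Rightarrow> int rel \<Rightarrow> int \<Rightarrow> nat" where
  "bracket n r a = card {b \<in> {a<..a + int n}. (b, a) \<in> r}"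

lemma bracket_le: "bracket n r a \<le> n"
proof -
  have "bracket n r a \<le> card {a<..a + int n}"
    unfolding bracket_def by (rule card_mono) auto
  then show ?thesis by simp
qed

lemma CTam_tito: "r \<in> CTam n \<Longrightarrow> tito n r"
  by (simp add: CTam_def)

lemma CTam_downward:
  assumes "r \<in> CTam n" and "a < b" and "b \<le> c" and "(c, a) \<in> r"
  shows "(b, a) \<in> r"
proof (cases "b = c")
  case False
  then have "\<not> (a, b) \<in> r"
    using assms unfolding CTam_def avoids_312_def by auto
  then show ?thesis using tito_total[OF CTam_tito[OF assms(1)]] by blast
qed (use assms in simp)

lemma bracket_periodic:
  assumes "tito n r"
  shows "bracket n r (a + k * int n) = bracket n r a"
proof -
  have "{b \<in> {a + k * int n<..a + k * int n + int n}. (b, a + k * int n) \<in> r}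
      = (\<lambda>b. b + k * int n) ` {b \<in> {a<..a + int n}. (b, a) \<in> r}" (is "?L = ?R")
  proof
    show "?L \<subseteq> ?R"
    proof
      fix x assume x: "x \<in> ?L"
      then have "(x - k * int n, a) \<in> r"
        using tito_shift[OF assms, of "x - k * int n" k a] by simp
      with x have "x - k * int n \<in> {b \<in> {a<..a + int n}. (b, a) \<in> r}" by auto
      then show "x \<in> ?R" by (rule rev_image_eqI) simp
    qed
    show "?R \<subseteq> ?L" using tito_shift[OF assms] by auto
  qed
  then show ?thesis
    unfolding bracket_def by (simp add: card_image inj_on_def)
qed

lemma bracket_mod:
  assumes "tito n r"
  shows "bracket n r (a mod int n) = bracket n r a"
  using bracket_periodic[OF assms, of "a mod int n" "a div int n"] by (simp add: mult.commute)

text \<open>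
  The segment of inverted partners is down-closed by avoidance of \<open>312\<close>. If it contains \<open>a + n\<close>,
  then \<open>\<dots> \<prec> a + 2 n \<prec> a + n \<prec> a\<close> by translation, and down-closure fills the gaps.
\<close>

lemma bracket_iff:
  assumes r: "r \<in> CTam n" and n: "n > 0" and ab: "a < b"
  shows "(b, a) \<in> r \<longleftrightarrow> bracket n r a = n \<or> b \<le> a + int (bracket n r a)"
proof -
  note t = CTam_tito[OF r]
  define J where "J = {b \<in> {a<..a + int n}. (b, a) \<in> r}"
  have fin: "finite J" unfolding J_def by (rule finite_subset[of _ "{a<..a + int n}"]) auto
  have "\<exists>m\<le>n. J = {a<..a + int m}"
  proof (cases "J = {}")
    case True
    then show ?thesis by (intro exI[of _ 0]) auto
  next
    case False
    then have M: "Max J \<in> J" "\<And>x. x \<in> J \<Longrightarrow> x \<le> Max J" using fin by auto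
    then have "J = {a<..Max J}" using CTam_downward[OF r] unfolding J_def by force
    moreover have "a < Max J" "Max J \<le> a + int n" using M(1) unfolding J_def by auto
    ultimately show ?thesis by (intro exI[of _ "nat (Max J - a)"]) auto
  qed
  then obtain m where m: "m \<le> n" "J = {a<..a + int m}" by blast
  have br: "bracket n r a = m"
    using m(2) unfolding bracket_def J_def[symmetric] by simp
  have near: "(b, a) \<in> r \<longleftrightarrow> b \<le> a + int m" if "a < b" "b \<le> a + int n" for b
  proof -
    have "(b, a) \<in> r \<longleftrightarrow> b \<in> J" using that unfolding J_def by simp
    then show ?thesis using m(2) that by simp
  qed
  show ?thesis
  proof (cases "m = n")
    case True
    have "(a + int j * int n, a) \<in> r" for j :: nat
    proof (induction j)
      case 0
      then show ?case using tito_refl[OF t] by simp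
    next
      case (Suc j)
      have "(a + int n, a) \<in> r" using near[of "a + int n"] n True by simp
      then have "(a + int n + int j * int n, a + int j * int n) \<in> r"
        by (simp only: tito_shift[OF t])
      then show ?case using tito_trans[OF t _ Suc] by (simp add: algebra_simps)
    qed
    moreover have "b \<le> a + int (nat (b - a)) * int n"
      using ab n mult_left_mono[of 1 "int n" "b - a"] by (simp add: algebra_simps)
    ultimately have "(b, a) \<in> r" using CTam_downward[OF r ab] by blast
    then show ?thesis using br True by simp
  next
    case False
    have "(b, a) \<notin> r" if "b > a + int n"
    proof
      assume "(b, a) \<in> r"
      then have "(a + int n, a) \<in> r" using CTam_downward[OF r _ _ \<open>(b, a) \<in> r\<close>] n that by simp
      then show False using near[of "a + int n"] n m(1) False by simp
    qed
    then show ?thesis using near[OF ab] br False m(1) by (cases "b \<le> a + int n") auto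
  qed
qed

text \<open>Transitivity of \<open>\<prec>\<close> on inverted pairs.\<close>

lemma bracket_nested:
  assumes r: "r \<in> CTam n" and "bracket n r a < n"
    and "a < b" and "b \<le> a + int (bracket n r a)"
  shows "b + int (bracket n r b) \<le> a + int (bracket n r a)"
proof (cases "bracket n r b = 0")
  case False
  let ?c = "b + int (bracket n r b)"
  have n: "n > 0" using assms(2) by simp
  have "(?c, b) \<in> r" using bracket_iff[OF r n, of b ?c] False by simp
  moreover have "(b, a) \<in> r" using bracket_iff[OF r n] assms by simp
  ultimately have "(?c, a) \<in> r" using tito_trans[OF CTam_tito[OF r]] by blast
  then show ?thesis using bracket_iff[OF r n, of a ?c] assms by simp
qed (use assms in simp)

lemma tito_le_iff_bracket_le:
  assumes r: "r \<in> CTam n" and s: "s \<in> CTam n" and n: "n > 0"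
  shows "tito_le n r s \<longleftrightarrow> (\<forall>a. bracket n r a \<le> bracket n s a)"
proof
  assume "tito_le n r s"
  then have sub: "\<And>a b. a < b \<Longrightarrow> (b, a) \<in> r \<Longrightarrow> (b, a) \<in> s"
    using tito_le_iff[OF CTam_tito[OF r] CTam_tito[OF s]] by blast
  show "\<forall>a. bracket n r a \<le> bracket n s a"
  proof
    fix a
    have "finite {b \<in> {a<..a + int n}. (b, a) \<in> s}"
      by (rule finite_subset[of _ "{a<..a + int n}"]) auto
    then show "bracket n r a \<le> bracket n s a"
      unfolding bracket_def by (rule card_mono) (use sub in auto)
  qed
next
  assume le: "\<forall>a. bracket n r a \<le> bracket n s a"
  have "(b, a) \<in> s" if "a < b" "(b, a) \<in> r" for a b
    using bracket_iff[OF r n that(1)] bracket_iff[OF s n that(1)] that(2) le[rule_format, of a]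
      bracket_le[of n s a] by auto
  then show "tito_le n r s"
    using tito_le_iff[OF CTam_tito[OF r] CTam_tito[OF s]] by blast
qed

lemma CTam_eqI:
  assumes r: "r \<in> CTam n" and s: "s \<in> CTam n" and n: "n > 0"
    and eq: "\<And>a. a \<in> {0..<int n} \<Longrightarrow> bracket n r a = bracket n s a"
  shows "r = s"
proof -
  note tr = CTam_tito[OF r] and ts = CTam_tito[OF s]
  have all: "bracket n r a = bracket n s a" for a
    using eq[of "a mod int n"] n bracket_mod[OF tr] bracket_mod[OF ts] by simp
  have inv: "(b, a) \<in> r \<longleftrightarrow> (b, a) \<in> s" if "a < b" for a b
    using bracket_iff[OF r n that] bracket_iff[OF s n that] all[of a] by simp
  have "(x, y) \<in> r \<longleftrightarrow> (x, y) \<in> s" for x y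
    using inv[of x y] inv[of y x] tito_refl[OF tr] tito_refl[OF ts] tito_total[OF tr, of x y]
      tito_total[OF ts, of x y] tito_antisym[OF tr, of x y] tito_antisym[OF ts, of x y]
    by (cases x y rule: linorder_cases) auto
  then show ?thesis by auto
qed

section \<open>Orders with a prescribed bracket vector\<close>

definition inverted :: "nat \<Rightarrow> (int \<Rightarrow> nat) \<Rightarrow> int \<Rightarrow> int \<Rightarrow> bool" where
  "inverted n c a b \<longleftrightarrow> a < b \<and> (c a = n \<or> b \<le> a + int (c a))"

definition order_of :: "nat \<Rightarrow> (int \<Rightarrow> nat) \<Rightarrow> int rel" where
  "order_of n c = {(x, y). x = y \<or> inverted n c y x \<or> (x < y \<and> \<not> inverted n c x y)}"

text \<open>
  Nestedness makes the inverted pairs transitive, and the other pairs are transitive because the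
  segments are down-closed. These two properties settle every relative position of three integers.
\<close>

lemma order_of_CTam:
  assumes le: "\<And>a. c a \<le> n"
    and per: "\<And>a. c (a + int n) = c a"
    and nested: "\<And>a b. c a < n \<Longrightarrow> a < b \<Longrightarrow> b \<le> a + int (c a) \<Longrightarrow> b + int (c b) \<le> a + int (c a)"
  shows "order_of n c \<in> CTam n"
proof -
  let ?i = "inverted n c"
  have lt: "a < b" if "?i a b" for a b
    using that by (simp add: inverted_def)
  have down: "?i a b" if "?i a d" "a < b" "b < d" for a b d
    using that by (auto simp: inverted_def)
  have trans: "?i a d" if ab: "?i a b" and bd: "?i b d" for a b d
  proof (cases "c a = n")
    case True
    then show ?thesis using lt[OF ab] lt[OF bd] by (simp add: inverted_def)
  next
    case False
    then have *: "b + int (c b) \<le> a + int (c a)" "c a < n"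
      using nested[of a b] ab le[of a] by (auto simp: inverted_def)
    then have "c b \<noteq> n" using lt[OF ab] by auto
    then show ?thesis using * lt[OF ab] bd by (auto simp: inverted_def)
  qed
  have rtrans: "(x, z) \<in> order_of n c"
    if xy: "(x, y) \<in> order_of n c" and yz: "(y, z) \<in> order_of n c" for x y z
  proof (cases "x = y \<or> y = z \<or> x = z")
    case True
    then show ?thesis using xy yz by (auto simp: order_of_def)
  next
    case False
    have 1: "?i y x \<or> x < y \<and> \<not> ?i x y" and 2: "?i z y \<or> y < z \<and> \<not> ?i y z"
      using xy yz False by (auto simp: order_of_def)
    have "?i z x \<or> x < z \<and> \<not> ?i x z"
      using 1 2 False lt[of y x] lt[of z y]
        down[of x z y] trans[of x z y] trans[of y x z] down[of y x z] down[of z y x] trans[of z y x]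
      by (smt (verit))
    then show ?thesis by (auto simp: order_of_def)
  qed
  have "linear_order (order_of n c)"
    unfolding linear_order_on_def partial_order_on_def preorder_on_def
  proof (intro conjI)
    show "refl (order_of n c)" by (auto simp: refl_on_def order_of_def)
    show "trans (order_of n c)" using rtrans by (meson transI)
    show "antisym (order_of n c)"
    proof (rule antisymI)
      fix x y assume "(x, y) \<in> order_of n c" "(y, x) \<in> order_of n c"
      then show "x = y" using lt[of x y] lt[of y x] by (auto simp: order_of_def)
    qed
    show "total (order_of n c)" by (auto simp: total_on_def order_of_def)
  qed simp
  moreover have "?i (a + int n) (b + int n) \<longleftrightarrow> ?i a b" for a b
    by (auto simp: inverted_def per)
  then have "(a, b) \<in> order_of n c \<longleftrightarrow> (a + int n, b + int n) \<in> order_of n c" for a b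
    by (simp add: order_of_def)
  moreover have "avoids_312 (order_of n c)"
    unfolding avoids_312_def
  proof clarify
    fix x y z assume "x < y" "y < z" "(z, x) \<in> order_of n c" "(x, y) \<in> order_of n c"
    then show False using lt[of y x] down[of x z y] by (auto simp: order_of_def)
  qed
  ultimately show ?thesis by (simp add: CTam_def tito_def)
qed

lemma bracket_order_of:
  assumes "\<And>a. c a \<le> n"
  shows "bracket n (order_of n c) a = c a"
proof -
  have "{b \<in> {a<..a + int n}. (b, a) \<in> order_of n c} = {a<..a + int (c a)}"
    using assms[of a] by (auto simp: order_of_def inverted_def)
  then show ?thesis by (simp add: bracket_def)
qed

section \<open>Real orders\<close>

lemma finite_before_infinite:
  assumes r: "r \<in> CTam n" and "bracket n r u < n" and "bracket n r p = n"
  shows "(u, p) \<in> r"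
proof (cases "u < p")
  case True
  have n: "n > 0" using assms(2) by simp
  \<comment> \<open>a finite segment containing \<open>p\<close> would contain \<open>p + n\<close>, by nestedness\<close>
  have "\<not> p \<le> u + int (bracket n r u)"
    using bracket_nested[OF r assms(2) True] assms(2,3) True by auto
  then have "(p, u) \<notin> r" using bracket_iff[OF r n True] assms(2) by simp
  then show ?thesis using tito_total[OF CTam_tito[OF r]] by blast
next
  case False
  then have "p < u" using assms(2,3) by (cases "p = u") auto
  then show ?thesis using bracket_iff[OF r, of p u] assms by simp
qed

lemma infinite_decreasing:
  assumes r: "r \<in> CTam n" and n: "n > 0" and p: "bracket n r p = n" and q: "bracket n r q = n"
  shows "(p, q) \<in> r \<longleftrightarrow> q \<le> p"
  using bracket_iff[OF r n, of q p] bracket_iff[OF r n, of p q] p q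
    tito_refl[OF CTam_tito[OF r], of p] tito_antisym[OF CTam_tito[OF r], of p q]
  by (cases p q rule: linorder_cases) auto

text \<open>
  The integers with infinite segment are ordered decreasingly after all the others. A block that
  meets them therefore has no maximum only if it is unbounded below on them, and its intervals are
  finite only if it contains no other integer. Then it has no minimum only if it is unbounded above
  on them. By convexity it contains all of them.
\<close>

lemma block_contains_infinite:
  assumes r: "r \<in> CTam n" and n: "n > 0" and I: "block r I"
    and x: "x \<in> I" "bracket n r x = n" and p: "bracket n r p = n"
  shows "p \<in> I"
proof -
  note t = CTam_tito[OF r]
  define K where "K = {z \<in> I. bracket n r z = n}"
  have xK: "x \<in> K" using x by (simp add: K_def)
  have convex: "z \<in> I" if "a \<in> I" "b \<in> I" "(a, z) \<in> r" "(z, b) \<in> r" for a b z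
    using I that unfolding block_def by blast
  have finite: "finite {z. (a, z) \<in> r \<and> (z, b) \<in> r}" if "a \<in> I" "b \<in> I" for a b
    using I that unfolding block_def by blast
  have nomin: "\<exists>z\<in>I. (z, m) \<in> r \<and> z \<noteq> m" and nomax: "\<exists>z\<in>I. (m, z) \<in> r \<and> z \<noteq> m"
    if "m \<in> I" for m
    using I that unfolding block_def by blast+
  have later_inf: "bracket n r z = n" if "bracket n r m = n" "(m, z) \<in> r" for m z
  proof (rule ccontr)
    assume "bracket n r z \<noteq> n"
    then have "bracket n r z < n" using bracket_le[of n r z] by simp
    then have "(z, m) \<in> r" using finite_before_infinite[OF r] that by blast
    then show False using tito_antisym[OF t] that \<open>bracket n r z \<noteq> n\<close> by blast
  qed
  have below: "\<exists>z\<in>K. z \<le> p"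
  proof (rule ccontr)
    assume "\<not> (\<exists>z\<in>K. z \<le> p)"
    then have bd: "z \<in> K \<Longrightarrow> p < z" for z by auto
    \<comment> \<open>the natural numbers \<open>z - p\<close> have a least member\<close>
    obtain m where m: "m \<in> K" and least: "\<And>z. z \<in> K \<Longrightarrow> m \<le> z"
    proof -
      obtain m where "m \<in> K" "\<And>z. z \<in> K \<Longrightarrow> nat (m - p) \<le> nat (z - p)"
        using ex_has_least_nat[of "\<lambda>z. z \<in> K" x "\<lambda>z. nat (z - p)"] xK by blast
      then show ?thesis using that[of m] bd by force
    qed
    obtain z where z: "z \<in> I" "(m, z) \<in> r" "z \<noteq> m" using nomax m by (auto simp: K_def)
    have zi: "bracket n r z = n" using later_inf z m by (auto simp: K_def)
    then have "z \<le> m" using infinite_decreasing[OF r n] z m by (auto simp: K_def)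
    then show False using least[of z] z zi by (auto simp: K_def)
  qed
  have above: "\<exists>z\<in>K. p \<le> z"
  proof (rule ccontr)
    assume "\<not> (\<exists>z\<in>K. p \<le> z)"
    then have bd: "z \<in> K \<Longrightarrow> z < p" for z by auto
    obtain m where m: "m \<in> K" and greatest: "\<And>z. z \<in> K \<Longrightarrow> z \<le> m"
    proof -
      obtain m where "m \<in> K" "\<And>z. z \<in> K \<Longrightarrow> nat (p - m) \<le> nat (p - z)"
        using ex_has_least_nat[of "\<lambda>z. z \<in> K" x "\<lambda>z. nat (p - z)"] xK by blast
      then show ?thesis using that[of m] bd by force
    qed
    obtain z where z: "z \<in> I" "(z, m) \<in> r" "z \<noteq> m" using nomin m by (auto simp: K_def)
    have mi: "bracket n r m = n" "m \<in> I" using m by (auto simp: K_def)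
    show False
    proof (cases "bracket n r z = n")
      case True
      then have "m \<le> z" using infinite_decreasing[OF r n] z mi by blast
      then show False using greatest[of z] z True by (auto simp: K_def)
    next
      case False
      then have zf: "bracket n r z < n" using bracket_le[of n r z] by simp
      \<comment> \<open>all translates \<open>m + j n\<close> with \<open>j \<ge> 0\<close> lie between \<open>z\<close> and \<open>m\<close>\<close>
      have "range (\<lambda>j::nat. m + int j * int n) \<subseteq> {y. (z, y) \<in> r \<and> (y, m) \<in> r}"
      proof clarify
        fix j :: nat
        have "bracket n r (m + int j * int n) = n" using bracket_periodic[OF t] mi by simp
        then show "(z, m + int j * int n) \<in> r \<and> (m + int j * int n, m) \<in> r"
          using finite_before_infinite[OF r zf] infinite_decreasing[OF r n _ mi(1)] by simp
      qed
      moreover have "infinite (range (\<lambda>j::nat. m + int j * int n))"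
        using n by (simp add: inj_on_def finite_image_iff)
      ultimately show False using finite[OF z(1) mi(2)] infinite_super by blast
    qed
  qed
  from below above obtain y z where "y \<in> K" "y \<le> p" "z \<in> K" "p \<le> z" by blast
  then show ?thesis
    using convex[of z y p] infinite_decreasing[OF r n] p by (auto simp: K_def)
qed

lemma real_iff_card_infinite:
  assumes r: "r \<in> CTam n" and n: "n > 0"
  shows "real_tito n r \<longleftrightarrow> card {a \<in> {0..<int n}. bracket n r a = n} \<noteq> 1"
proof
  note t = CTam_tito[OF r]
  assume real: "real_tito n r"
  show "card {a \<in> {0..<int n}. bracket n r a = n} \<noteq> 1"
  proof
    assume "card {a \<in> {0..<int n}. bracket n r a = n} = 1"
    then obtain a where a: "{a \<in> {0..<int n}. bracket n r a = n} = {a}"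
      by (rule card_1_singletonE)
    define I where "I = {x. bracket n r x = n}"
    have a0: "a \<in> {0..<int n}" "bracket n r a = n" using a by auto
    have Imod: "I = {x. x mod int n = a}"
    proof -
      have "bracket n r x = n \<longleftrightarrow> x mod int n \<in> {a \<in> {0..<int n}. bracket n r a = n}" for x
        using n bracket_mod[OF t, of x] by simp
      then show ?thesis unfolding I_def a by simp
    qed
    have dec: "(p, q) \<in> r \<longleftrightarrow> q \<le> p" if "p \<in> I" "q \<in> I" for p q
      using infinite_decreasing[OF r n] that by (simp add: I_def)
    have conv: "x \<in> I" if "p \<in> I" "(p, x) \<in> r" for p x
    proof (rule ccontr)
      assume x: "x \<notin> I"
      then have "(x, p) \<in> r"
        using finite_before_infinite[OF r, of x p] bracket_le[of n r x] that by (simp add: I_def)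
      then show False using tito_antisym[OF t that(2)] that(1) x by simp
    qed
    have shift: "x + k * int n \<in> I" if "x \<in> I" for x k
      using bracket_periodic[OF t] that by (simp add: I_def)
    have "block r I"
      unfolding block_def
    proof (intro conjI)
      show "I \<noteq> {}" using a0 by (auto simp: I_def)
      show "\<forall>a\<in>I. \<forall>b\<in>I. \<forall>x. (a, x) \<in> r \<and> (x, b) \<in> r \<longrightarrow> x \<in> I" using conv by blast
      show "\<not> (\<exists>m\<in>I. \<forall>x\<in>I. (x, m) \<in> r \<longrightarrow> x = m)"
      proof clarify
        fix m assume "m \<in> I" "\<forall>x\<in>I. (x, m) \<in> r \<longrightarrow> x = m"
        then show False using shift[of m 1] dec[of "m + 1 * int n" m] n by force
      qed
      show "\<not> (\<exists>m\<in>I. \<forall>x\<in>I. (m, x) \<in> r \<longrightarrow> x = m)"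
      proof clarify
        fix m assume "m \<in> I" "\<forall>x\<in>I. (m, x) \<in> r \<longrightarrow> x = m"
        then show False using shift[of m "-1"] dec[of m "m + (-1) * int n"] n by force
      qed
      show "\<forall>a\<in>I. \<forall>b\<in>I. finite {x. (a, x) \<in> r \<and> (x, b) \<in> r}"
      proof (intro ballI)
        fix p q assume pq: "p \<in> I" "q \<in> I"
        have "{x. (p, x) \<in> r \<and> (x, q) \<in> r} \<subseteq> {q..p}"
        proof clarify
          fix x assume x: "(p, x) \<in> r" "(x, q) \<in> r"
          then have "x \<in> I" using conv pq by blast
          then show "x \<in> {q..p}" using x dec pq by auto
        qed
        then show "finite {x. (p, x) \<in> r \<and> (x, q) \<in> r}" by (rule finite_subset) simp
      qed
    qed
    moreover have "{i \<in> {0..<int n}. {x. [x = i] (mod int n)} \<subseteq> I} = {a}"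
    proof -
      have "{x. [x = i] (mod int n)} \<subseteq> I \<longleftrightarrow> i = a" if "i \<in> {0..<int n}" for i
      proof
        assume "{x. [x = i] (mod int n)} \<subseteq> I"
        then have "i \<in> I" by auto
        then show "i = a" using that by (simp add: Imod)
      qed (use a0 in \<open>auto simp: Imod cong_def\<close>)
      then show ?thesis using a0 by auto
    qed
    then have "block_size n I = 1" unfolding block_size_def by simp
    ultimately have "waxing n r I" using real by (simp add: real_tito_def)
    then have "(a, a + 1 * int n) \<in> r" using a0 by (simp add: waxing_def I_def)
    then show False using dec[of a "a + 1 * int n"] shift[of a 1] a0 n by (simp add: I_def)
  qed
next
  note t = CTam_tito[OF r]
  assume card: "card {a \<in> {0..<int n}. bracket n r a = n} \<noteq> 1" (is "card ?Z \<noteq> 1")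
  have "waxing n r I" if I: "block r I" and size: "block_size n I = 1" for I
    unfolding waxing_def
  proof (rule ballI, rule ccontr)
    fix x assume x: "x \<in> I" and "(x, x + int n) \<notin> r"
    then have "(x + int n, x) \<in> r" using tito_total[OF t] by blast
    then have xi: "bracket n r x = n"
      using bracket_iff[OF r n, of x "x + int n"] n bracket_le[of n r x] by auto
    let ?S = "{i \<in> {0..<int n}. {x. [x = i] (mod int n)} \<subseteq> I}"
    have "?Z \<subseteq> ?S"
    proof
      fix i assume "i \<in> ?Z"
      then have i: "i \<in> {0..<int n}" "bracket n r i = n" by auto
      have "y \<in> I" if "[y = i] (mod int n)" for y
      proof -
        have "bracket n r y = n"
          using that i(2) bracket_mod[OF t, of y] bracket_mod[OF t, of i] by (simp add: cong_def)
        then show ?thesis using block_contains_infinite[OF r n I x xi] by blast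
      qed
      then show "i \<in> ?S" using i by blast
    qed
    moreover have "card ?S = 1" using size by (simp add: block_size_def)
    ultimately have "card ?Z \<le> 1"
      by (metis (no_types, lifting) card_mono card.infinite zero_neq_one)
    moreover have "x mod int n \<in> ?Z" using n xi bracket_mod[OF t, of x] by simp
    moreover have "finite ?Z" by (rule finite_subset[of _ "{0..<int n}"]) auto
    ultimately have "card ?Z \<noteq> 0" "card ?Z \<le> 1" by (metis card_0_eq empty_iff, blast)
    then show False using card by linarith
  qed
  then show "real_tito n r" using t by (simp add: real_tito_def)
qed

section \<open>Counting the values taken along a chain\<close>

definition attained :: "nat \<Rightarrow> int rel set \<Rightarrow> (int \<times> nat) set" where
  "attained n C = {(a, v). a \<in> {0..<int n} \<and> 0 < v \<and> (\<exists>r\<in>C. bracket n r a = v)}"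

definition attained_upto :: "nat \<Rightarrow> int rel set \<Rightarrow> int rel \<Rightarrow> (int \<times> nat) set" where
  "attained_upto n C r = {(a, v) \<in> attained n C. v \<le> bracket n r a}"

definition attained_finite :: "nat \<Rightarrow> int rel set \<Rightarrow> (int \<times> nat) set" where
  "attained_finite n C = {(a, v) \<in> attained n C. v < n}"

lemma attained_subset: "attained n C \<subseteq> {0..<int n} \<times> {..n}"
  using bracket_le by (auto simp: attained_def)

lemma finite_attained: "finite (attained n C)"
  by (rule finite_subset[OF attained_subset]) simp

text \<open>
  If the segment of \<open>a\<close> ends at \<open>a + v\<close> in \<open>r\<close>, then it contains \<open>a + v\<close> in \<open>s\<close>. There the segment
  of \<open>a + v\<close> ends at \<open>a + n\<close>, so nestedness makes the segment of \<open>a\<close> reach \<open>a + n\<close>. Now \<open>a + n\<close> has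
  an infinite segment and lies in the finite segment of \<open>a + v\<close>, which nestedness forbids.
\<close>

lemma no_opposite_values:
  assumes s: "s \<in> CTam n" and le: "\<And>a. bracket n r a \<le> bracket n s a"
    and v: "0 < v" "v < n" and ra: "bracket n r a = v"
    and sb: "bracket n s (a + int v) = n - v"
  shows False
proof -
  have "v \<le> bracket n s a" using le[of a] ra by simp
  have "bracket n s a = n"
  proof (rule ccontr)
    assume "bracket n s a \<noteq> n"
    then have lt: "bracket n s a < n" using bracket_le[of n s a] by simp
    then show False
      using bracket_nested[OF s lt, of "a + int v"] v sb \<open>v \<le> bracket n s a\<close> by simp
  qed
  then have "bracket n s (a + int n) = n"
    using bracket_periodic[OF CTam_tito[OF s], of a 1] by simp
  then show False
    using bracket_nested[OF s, of "a + int v" "a + int n"] v sb by simp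
qed

text \<open>The pair \<open>(a, v)\<close> is charged to the residue classes of \<open>a\<close> and \<open>a + v\<close>.\<close>

lemma card_attained_finite:
  assumes C: "C \<subseteq> CTam n" and chain: "\<And>r s. r \<in> C \<Longrightarrow> s \<in> C \<Longrightarrow> tito_le n r s \<or> tito_le n s r"
  shows "card (attained_finite n C) \<le> n choose 2"
proof -
  define ends where "ends = (\<lambda>(a, v). {a, (a + int v) mod int n})"
  have other: "(a + int v) mod int n \<noteq> a"
    if "0 < v" "v < n" "a \<in> {0..<int n}" for a v
  proof
    assume "(a + int v) mod int n = a"
    then have "int n dvd int v" 
      using that by (metis add_diff_cancel_left' atLeastLessThan_iff mod_eq_dvd_iff mod_pos_pos_trivial)
    then show False using that by (auto dest: zdvd_imp_le)
  qed
  have "inj_on ends (attained_finite n C)"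
  proof (rule inj_onI, clarify)
    fix a v b w
    assume av: "(a, v) \<in> attained_finite n C" and bw: "(b, w) \<in> attained_finite n C"
      and eq: "ends (a, v) = ends (b, w)"
    obtain r where r: "r \<in> C" "bracket n r a = v" "a \<in> {0..<int n}" "0 < v" "v < n"
      using av by (auto simp: attained_finite_def attained_def)
    obtain s where s: "s \<in> C" "bracket n s b = w" "b \<in> {0..<int n}" "0 < w" "w < n"
      using bw by (auto simp: attained_finite_def attained_def)
    have n: "n > 0" using r by simp
    have rC: "r \<in> CTam n" and sC: "s \<in> CTam n" using r s C by auto
    note tr = CTam_tito[OF rC] and ts = CTam_tito[OF sC]
    from eq consider
      (same) "a = b" "(a + int v) mod int n = (a + int w) mod int n"
      | (opp) "b = (a + int v) mod int n" "a = (b + int w) mod int n"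
      using other[of v a] other[of w b] r s by (auto simp: ends_def doubleton_eq_iff)
    then show "a = b \<and> v = w"
    proof cases
      case same
      then have "int n dvd (int v - int w)" by (simp add: mod_eq_dvd_iff)
      moreover have "\<bar>int v - int w\<bar> < int n" using r(4,5) s(4,5) by linarith
      ultimately have "int v - int w = 0" using dvd_imp_le_int[of "int v - int w" "int n"] by force
      then show ?thesis using same by simp
    next
      case opp
      have "(a + int v + int w) mod int n = a mod int n"
        using opp by (metis mod_add_left_eq mod_mod_trivial)
      then have "int n dvd (int v + int w)" by (simp add: mod_eq_dvd_iff)
      then obtain k where k: "int v + int w = int n * k" by blast
      moreover have "0 < int n * k" "int n * k < int n * 2"
        unfolding k[symmetric] using r(4,5) s(4,5) by linarith+
      then have "0 < k" "k < 2" using n by (simp_all add: zero_less_mult_iff)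
      then have "k = 1" by simp
      ultimately have w: "w = n - v" and v: "v = n - w" by auto
      have sb: "bracket n s (a + int v) = n - v"
        using bracket_mod[OF ts, of "a + int v"] opp(1) s(2) unfolding w[symmetric] by simp
      have ra: "bracket n r (b + int w) = n - w"
        using bracket_mod[OF tr, of "b + int w"] opp(2) r(2) unfolding v[symmetric] by simp
      from chain[OF r(1) s(1)] have False
      proof
        assume "tito_le n r s"
        then have "\<And>a. bracket n r a \<le> bracket n s a"
          using tito_le_iff_bracket_le[OF rC sC n] by blast
        then show False using no_opposite_values[OF sC _ r(4,5,2) sb] by blast
      next
        assume "tito_le n s r"
        then have "\<And>a. bracket n s a \<le> bracket n r a"
          using tito_le_iff_bracket_le[OF sC rC n] by blast
        then show False using no_opposite_values[OF rC _ s(4,5,2) ra] by blast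
      qed
      then show ?thesis ..
    qed
  qed
  moreover have "ends ` attained_finite n C \<subseteq> {X. X \<subseteq> {0..<int n} \<and> card X = 2}"
  proof clarify
    fix a v assume "(a, v) \<in> attained_finite n C"
    then have av: "a \<in> {0..<int n}" "0 < v" "v < n"
      by (auto simp: attained_finite_def attained_def)
    then show "ends (a, v) \<subseteq> {0..<int n} \<and> card (ends (a, v)) = 2"
      using other[of v a] by (auto simp: ends_def card_insert_if)
  qed
  moreover have "finite {X. X \<subseteq> {0..<int n} \<and> card X = 2}"
    by (rule finite_subset[of _ "Pow {0..<int n}"]) auto
  ultimately have "card (attained_finite n C) \<le> card {X. X \<subseteq> {0..<int n} \<and> card X = 2}"
    by (metis card_image card_mono)
  then show ?thesis by (simp add: n_subsets)
qed

lemma Suc_choose_two: "(n + 1) choose 2 = n + (n choose 2)"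
  by (simp add: numeral_2_eq_2)

lemma card_attained:
  assumes C: "C \<subseteq> CTam n" and chain: "\<And>r s. r \<in> C \<Longrightarrow> s \<in> C \<Longrightarrow> tito_le n r s \<or> tito_le n s r"
  shows "card (attained n C) \<le> (n + 1) choose 2"
proof -
  have "attained n C \<subseteq> attained_finite n C \<union> (\<lambda>a. (a, n)) ` {0..<int n}"
    using attained_subset[of n C] by (force simp: attained_finite_def)
  moreover have fin: "finite (attained_finite n C)"
    by (rule finite_subset[OF _ finite_attained[of n C]]) (auto simp: attained_finite_def)
  ultimately have "card (attained n C) \<le> card (attained_finite n C \<union> (\<lambda>a. (a, n)) ` {0..<int n})"
    by (intro card_mono) auto
  also have "\<dots> \<le> card (attained_finite n C) + card ((\<lambda>a. (a, n)) ` {0..<int n})"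
    by (rule card_Un_le)
  also have "card ((\<lambda>a. (a, n)) ` {0..<int n}) = n"
    by (simp add: card_image inj_on_def)
  finally show ?thesis
    using card_attained_finite[OF assms] unfolding Suc_choose_two by linarith
qed

lemma attained_upto_strict_mono:
  assumes r: "r \<in> C" and s: "s \<in> C" and C: "C \<subseteq> CTam n" and n: "n > 0"
    and le: "tito_le n r s" and "r \<noteq> s"
  shows "attained_upto n C r \<subset> attained_upto n C s"
proof -
  have rC: "r \<in> CTam n" and sC: "s \<in> CTam n" using r s C by auto
  have le': "bracket n r a \<le> bracket n s a" for a
    using le tito_le_iff_bracket_le[OF rC sC n] by blast
  obtain a where a: "a \<in> {0..<int n}" "bracket n r a < bracket n s a"
    using CTam_eqI[OF rC sC n] \<open>r \<noteq> s\<close> le' by (meson order_le_imp_less_or_eq)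
  then have "(a, bracket n s a) \<in> attained_upto n C s - attained_upto n C r"
    using s by (auto simp: attained_upto_def attained_def)
  moreover have "attained_upto n C r \<subseteq> attained_upto n C s"
    using le' by (auto simp: attained_upto_def intro: order_trans)
  ultimately show ?thesis by blast
qed

lemma finite_attained_upto: "finite (attained_upto n C r)"
  by (rule finite_subset[OF _ finite_attained[of n C]]) (auto simp: attained_upto_def)

lemma card_le_of_strict_weight:
  fixes w :: "'a \<Rightarrow> nat"
  assumes total: "\<And>x y. x \<in> C \<Longrightarrow> y \<in> C \<Longrightarrow> le x y \<or> le y x"
    and strict: "\<And>x y. x \<in> C \<Longrightarrow> y \<in> C \<Longrightarrow> le x y \<Longrightarrow> x \<noteq> y \<Longrightarrow> w x < w y"
    and bound: "\<And>x. x \<in> C \<Longrightarrow> w x \<le> L"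
  shows "finite C \<and> card C \<le> L + 1"
proof -
  have inj: "inj_on w C"
    by (rule inj_onI) (metis total strict less_irrefl)
  have sub: "w ` C \<subseteq> {..L}" using bound by auto
  have "finite C" using inj sub by (meson finite_atMost finite_imageD finite_subset)
  moreover have "card C \<le> card {..L}" using inj sub by (intro card_inj_on_le) auto
  ultimately show ?thesis by simp
qed

lemma CTam_chain_bound:
  assumes n: "n > 0" and C: "C \<subseteq> CTam n"
    and chain: "\<And>r s. r \<in> C \<Longrightarrow> s \<in> C \<Longrightarrow> tito_le n r s \<or> tito_le n s r"
  shows "finite C \<and> card C \<le> ((n + 1) choose 2) + 1"
proof (rule card_le_of_strict_weight[where w = "\<lambda>r. card (attained_upto n C r)", OF chain])
  fix r s assume "r \<in> C" "s \<in> C" "tito_le n r s" "r \<noteq> s"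
  then show "card (attained_upto n C r) < card (attained_upto n C s)"
    using attained_upto_strict_mono[OF _ _ C n] finite_attained_upto by (meson psubset_card_mono)
next
  fix r
  have "card (attained_upto n C r) \<le> card (attained n C)"
    by (rule card_mono[OF finite_attained]) (auto simp: attained_upto_def)
  then show "card (attained_upto n C r) \<le> (n + 1) choose 2" using card_attained[OF C chain] by simp
qed

text \<open>
  The weight is lowered by one as soon as an infinite entry appears. It is still strictly
  increasing, because a real order has no infinite entry or at least two. When no entry is
  infinite, only finite values count, so the weight is at most \<open>n choose 2\<close>. The maximal weight
  thus drops by one in both cases.
\<close>

lemma ATam_chain_bound:
  assumes n: "n > 0" and A: "C \<subseteq> ATam n"
    and chain: "\<And>r s. r \<in> C \<Longrightarrow> s \<in> C \<Longrightarrow> tito_le n r s \<or> tito_le n s r"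
  shows "finite C \<and> card C \<le> (((n + 1) choose 2) - 1) + 1"
proof -
  have C: "C \<subseteq> CTam n" using A by (auto simp: ATam_def CTam_def real_tito_def)
  define Z where "Z = (\<lambda>r. {a \<in> {0..<int n}. bracket n r a = n})"
  define w where "w = (\<lambda>r. card (attained_upto n C r) - (if Z r = {} then 0 else 1))"
  have finZ: "finite (Z r)" for r
    unfolding Z_def by (rule finite_subset[of _ "{0..<int n}"]) auto
  have Z_upto: "(\<lambda>a. (a, n)) ` Z r \<subseteq> attained_upto n C r" if "r \<in> C" for r
    using that n by (auto simp: Z_def attained_upto_def attained_def)
  have pos: "card (attained_upto n C r) \<ge> 1" if "r \<in> C" "Z r \<noteq> {}" for r
    using Z_upto[OF that(1)] that(2) finite_attained_upto[of n C r]
    by (metis One_nat_def Suc_leI card_gt_0_iff image_is_empty subset_empty)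
  have Z1: "card (Z r) \<noteq> 1" if "r \<in> C" for r
    using real_iff_card_infinite[of r n] that C A n by (auto simp: Z_def ATam_def)
  show ?thesis
  proof (rule card_le_of_strict_weight[where w = w, OF chain])
    fix r s assume rs: "r \<in> C" "s \<in> C" "tito_le n r s" "r \<noteq> s"
    have sub: "attained_upto n C r \<subset> attained_upto n C s"
      using attained_upto_strict_mono[OF _ _ C n] rs by blast
    then have less: "card (attained_upto n C r) < card (attained_upto n C s)"
      using finite_attained_upto by (meson psubset_card_mono)
    show "w r < w s"
    proof (cases "Z r = {} \<and> Z s \<noteq> {}")
      case True
      let ?N = "(\<lambda>a. (a, n)) ` Z s"
      have "card (Z s) \<noteq> 0" using finZ[of s] True by simp
      then have "card (Z s) \<ge> 2" using Z1[OF rs(2)] by linarith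
      moreover have "card ?N = card (Z s)" by (simp add: card_image inj_on_def)
      moreover have "?N \<inter> attained_upto n C r = {}"
      proof -
        have "\<not> n \<le> bracket n r a" if "a \<in> Z s" for a
          using True that bracket_le[of n r a] by (auto simp: Z_def)
        then show ?thesis by (auto simp: attained_upto_def)
      qed
      then have "card (?N \<union> attained_upto n C r) = card ?N + card (attained_upto n C r)"
        using finZ finite_attained_upto by (intro card_Un_disjoint) auto
      moreover have "card (?N \<union> attained_upto n C r) \<le> card (attained_upto n C s)"
        using Z_upto[OF rs(2)] sub by (intro card_mono finite_attained_upto) auto
      ultimately show ?thesis using True by (simp add: w_def)
    next
      case False
      then show ?thesis using less pos[OF rs(1)] unfolding w_def by (cases "Z r = {}") auto
    qed
  next
    fix r assume r: "r \<in> C"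
    show "w r \<le> ((n + 1) choose 2) - 1"
    proof (cases "Z r = {}")
      case True
      have "attained_upto n C r \<subseteq> attained_finite n C"
      proof clarify
        fix a v assume av: "(a, v) \<in> attained_upto n C r"
        then have "a \<in> {0..<int n}" "v \<le> bracket n r a"
          by (auto simp: attained_upto_def attained_def)
        then have "v < n" using True bracket_le[of n r a] unfolding Z_def by fastforce
        then show "(a, v) \<in> attained_finite n C"
          using av by (simp add: attained_upto_def attained_finite_def)
      qed
      moreover have "finite (attained_finite n C)"
        by (rule finite_subset[OF _ finite_attained[of n C]]) (auto simp: attained_finite_def)
      ultimately have "card (attained_upto n C r) \<le> card (attained_finite n C)"
        by (intro card_mono)
      then show ?thesis
        using card_attained_finite[OF C chain] n True unfolding Suc_choose_two w_def by simp
    next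
      case False
      have "card (attained_upto n C r) \<le> card (attained n C)"
        by (rule card_mono[OF finite_attained]) (auto simp: attained_upto_def)
      then show ?thesis using card_attained[OF C chain] False by (simp add: w_def)
    qed
  qed
qed

section \<open>A longest chain\<close>

text \<open>
  The chain is indexed by a time \<open>t\<close> from \<open>0\<close> to \<open>(n + 1) choose 2\<close>. The entry of the class \<open>a\<close>
  takes \<open>n - 1 - a\<close> unit steps to fill up, so it starts to grow at time \<open>start_time n a\<close>, and all
  entries are full at time \<open>start_time n n\<close>. From then on they become infinite one by one.
\<close>

definition start_time :: "nat \<Rightarrow> nat \<Rightarrow> nat" where
  "start_time n a = (\<Sum>i<a. n - 1 - i)"

definition stair :: "nat \<Rightarrow> nat \<Rightarrow> nat \<Rightarrow> nat" where
  "stair n t a = (if start_time n n + a < t then n else min (n - 1 - a) (t - start_time n a))"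

definition stair_order :: "nat \<Rightarrow> nat \<Rightarrow> int rel" where
  "stair_order n t = order_of n (\<lambda>x. stair n t (nat (x mod int n)))"

lemma start_time_eq_choose: "start_time n n = n choose 2"
proof -
  have "start_time n n = (\<Sum>i<n. i)"
    unfolding start_time_def using sum.nat_diff_reindex[of "\<lambda>i. i" n] by simp
  also have "\<dots> = n choose 2"
    by (induction n) (simp_all add: numeral_2_eq_2)
  finally show ?thesis .
qed

lemma start_time_mono: "a \<le> b \<Longrightarrow> start_time n a \<le> start_time n b"
  unfolding start_time_def by (rule sum_mono2) auto

lemma stair_le: "stair n t a \<le> n"
  by (auto simp: stair_def)

lemma stair_mono: "t \<le> u \<Longrightarrow> stair n t a \<le> stair n u a"
  by (auto simp: stair_def min_def)

text \<open>
  While the entry of \<open>a\<close> grows, the later entries vanish. Once it is full, its segment ends at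
  \<open>n - 1\<close>, where all the later finite segments end at the latest.
\<close>

lemma stair_nested:
  assumes "stair n t a < n" and "0 < d" and "d \<le> stair n t a"
  shows "a + d < n" and "d + stair n t (a + d) \<le> stair n t a"
proof -
  have t: "t \<le> start_time n n + a" and e: "stair n t a = min (n - 1 - a) (t - start_time n a)"
    using assms(1) by (auto simp: stair_def split: if_splits)
  show lt: "a + d < n" using e assms(2,3) by linarith
  have e': "stair n t (a + d) = min (n - 1 - (a + d)) (t - start_time n (a + d))"
    using t by (simp add: stair_def)
  have S: "start_time n (Suc a) = start_time n a + (n - 1 - a)" by (simp add: start_time_def)
  have le: "start_time n (Suc a) \<le> start_time n (a + d)" using assms(2) by (intro start_time_mono) simp
  show "d + stair n t (a + d) \<le> stair n t a"
  proof (cases "start_time n (Suc a) \<le> t")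
    case True
    then have "stair n t a = n - 1 - a" using e S by (simp add: min_def)
    moreover have "stair n t (a + d) \<le> n - 1 - (a + d)" using e' by simp
    ultimately show ?thesis using lt by linarith
  next
    case False
    then have "stair n t (a + d) = 0" using e' le by simp
    then show ?thesis using assms(3) by simp
  qed
qed

lemma sum_stair: "t \<le> start_time n n \<Longrightarrow> (\<Sum>a<m. stair n t a) = min t (start_time n m)"
proof (induction m)
  case (Suc m)
  have "stair n t m = min (n - 1 - m) (t - start_time n m)" using Suc.prems by (simp add: stair_def)
  moreover have "start_time n (Suc m) = start_time n m + (n - 1 - m)" by (simp add: start_time_def)
  moreover have "min t k + min d (t - k) = min t (k + d)" for k d
    by (cases "t \<le> k") (auto simp: min_def)
  ultimately show ?case using Suc by simp
qed (simp add: start_time_def)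

text \<open>
  Until all entries are full, they sum to \<open>t\<close>. After that, the infinite entries tell the time.
\<close>

lemma stair_distinct:
  assumes "t < u" and "u \<le> start_time n n + n"
  shows "\<exists>a<n. stair n t a \<noteq> stair n u a"
proof (cases "u \<le> start_time n n")
  case True
  then have "(\<Sum>a<n. stair n t a) \<noteq> (\<Sum>a<n. stair n u a)"
    using assms sum_stair[of t n n] sum_stair[of u n n] by simp
  then show ?thesis by (metis lessThan_iff sum.cong)
next
  case False
  \<comment> \<open>the entry that becomes infinite at time \<open>u\<close>\<close>
  define a where "a = u - 1 - start_time n n"
  have "a < n" "start_time n n + a < u" "\<not> start_time n n + a < t"
    using assms False by (auto simp: a_def)
  moreover from this have "stair n t a < n" by (auto simp: stair_def)
  ultimately show ?thesis by (intro exI[of _ a]) (simp add: stair_def)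
qed

lemma stair_order_CTam:
  assumes n: "n > 0"
  shows "stair_order n t \<in> CTam n"
  unfolding stair_order_def
proof (rule order_of_CTam)
  show "stair n t (nat (a mod int n)) \<le> n" for a by (rule stair_le)
  show "stair n t (nat ((a + int n) mod int n)) = stair n t (nat (a mod int n))" for a
    by (simp only: mod_add_self2)
  fix a b :: int
  define p where "p = nat (a mod int n)"
  define d where "d = nat (b - a)"
  assume lt: "stair n t (nat (a mod int n)) < n" and ab: "a < b"
    and b: "b \<le> a + int (stair n t (nat (a mod int n)))"
  have d: "0 < d" "d \<le> stair n t p" "b = a + int d" using ab b by (auto simp: d_def p_def)
  note nested = stair_nested[OF _ d(1,2)]
  have pd: "p + d < n" using nested lt by (simp add: p_def)
  have p: "int p = a mod int n" using n by (simp add: p_def)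
  have "b mod int n = (int p + int d) mod int n" unfolding d(3) p by (simp add: mod_add_left_eq)
  also have "\<dots> = int (p + d)" using pd by simp
  finally have "nat (b mod int n) = p + d" by simp
  then show "b + int (stair n t (nat (b mod int n))) \<le> a + int (stair n t (nat (a mod int n)))"
    using nested(2) lt d(3) by (simp add: p_def)
qed

lemma bracket_stair_order: "bracket n (stair_order n t) a = stair n t (nat (a mod int n))"
  unfolding stair_order_def
  by (rule bracket_order_of[where c = "\<lambda>x. stair n t (nat (x mod int n))", OF stair_le])

lemma stair_order_le:
  assumes n: "n > 0" and "t \<le> u"
  shows "tito_le n (stair_order n t) (stair_order n u)"
proof -
  have "bracket n (stair_order n t) a \<le> bracket n (stair_order n u) a" for a
    unfolding bracket_stair_order by (rule stair_mono[OF assms(2)])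
  then show ?thesis
    using tito_le_iff_bracket_le[OF stair_order_CTam[OF n] stair_order_CTam[OF n] n] by blast
qed

lemma stair_order_inj:
  assumes n: "n > 0"
  shows "inj_on (stair_order n) {..start_time n n + n}"
proof -
  have neq: "stair_order n t \<noteq> stair_order n u" if tu: "t < u" "u \<le> start_time n n + n" for t u
  proof -
    obtain a where a: "a < n" "stair n t a \<noteq> stair n u a" using stair_distinct[OF tu] by blast
    then have "bracket n (stair_order n t) (int a) \<noteq> bracket n (stair_order n u) (int a)"
      by (simp add: bracket_stair_order)
    then show ?thesis by auto
  qed
  show ?thesis
  proof (rule inj_onI, rule ccontr)
    fix t u assume "t \<in> {..start_time n n + n}" "u \<in> {..start_time n n + n}"
      and eq: "stair_order n t = stair_order n u" and "t \<noteq> u"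
    then consider "t < u" "u \<le> start_time n n + n" | "u < t" "t \<le> start_time n n + n"
      by (meson atMost_iff linorder_neqE_nat)
    then show False using neq[of t u] neq[of u t] eq by cases auto
  qed
qed

lemma stair_order_real:
  assumes n: "n \<ge> 2" and t: "t \<noteq> start_time n n + 1"
  shows "stair_order n t \<in> ATam n"
proof -
  have n0: "n > 0" using n by simp
  have inf: "bracket n (stair_order n t) a = n \<longleftrightarrow> start_time n n + nat a < t"
    if "a \<in> {0..<int n}" for a
    using that by (auto simp: bracket_stair_order stair_def)
  have "card {a \<in> {0..<int n}. bracket n (stair_order n t) a = n} \<noteq> 1" (is "card ?Z \<noteq> 1")
  proof (cases "t \<le> start_time n n")
    case True
    then have "?Z = {}" using inf by auto
    then show ?thesis by (simp only: card.empty)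
  next
    case False
    then have "{0, 1} \<subseteq> ?Z" using inf[of 0] inf[of 1] t n by auto
    moreover have "finite ?Z" by (rule finite_subset[of _ "{0..<int n}"]) auto
    ultimately have "card {0, 1::int} \<le> card ?Z" by (intro card_mono)
    then show ?thesis by simp
  qed
  then have "real_tito n (stair_order n t)"
    using real_iff_card_infinite[OF stair_order_CTam[OF n0] n0] by blast
  then show ?thesis using stair_order_CTam[OF n0, of t] by (simp add: ATam_def CTam_def)
qed

section \<open>Maximum chain lengths\<close>

text \<open>A chain that attains the bound is maximal, since a larger chain would violate the bound.\<close>

lemma is_max_chain_lengthI:
  assumes bound: "\<And>C. pred_on.chain P le C \<Longrightarrow> finite C \<and> card C \<le> L + 1"
    and C: "pred_on.chain P le C" "card C = L + 1"
  shows "is_max_chain_length P le L"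
proof -
  have "pred_on.maxchain P le C"
    unfolding pred_on.maxchain_def
  proof (intro conjI notI)
    assume "\<exists>S. pred_on.chain P le S \<and> C \<subset> S"
    then obtain S where S: "pred_on.chain P le S" "C \<subset> S" by blast
    then have "card C < card S" using bound by (intro psubset_card_mono) auto
    then show False using bound[OF S(1)] C(2) by simp
  qed (rule C(1))
  moreover have "finite C \<and> chain_length C \<le> L" if "pred_on.maxchain P le C" for C
  proof -
    have "pred_on.chain P le C" using that by (simp add: pred_on.maxchain_def)
    then have "finite C \<and> card C \<le> L + 1" by (rule bound)
    then show ?thesis by (auto simp: chain_length_def)
  qed
  moreover have "finite C" "chain_length C = L"
    using bound[OF C(1)] C(2) by (auto simp: chain_length_def)
  ultimately show ?thesis unfolding is_max_chain_length_def by blast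
qed

lemma tito_le_refl: "tito_le n r r"
  by (simp add: tito_le_def)

lemma tito_chain_iff:
  "pred_on.chain P (tito_le n) C \<longleftrightarrow> C \<subseteq> P \<and> (\<forall>r\<in>C. \<forall>s\<in>C. tito_le n r s \<or> tito_le n s r)"
proof -
  have "(tito_le n)\<^sup>=\<^sup>= = tito_le n"
    using tito_le_refl by (intro ext) auto
  then show ?thesis by (simp add: pred_on.chain_def)
qed

theorem theorem8p4:
  fixes n :: nat
  assumes "n \<ge> 2"
  shows "is_max_chain_length (CTam n) (tito_le n) ((n + 1) choose 2)
       \<and> is_max_chain_length (ATam n) (tito_le n) (((n + 1) choose 2) - 1)"
proof -
  have n: "n > 0" using assms by simp
  have N: "start_time n n + n = (n + 1) choose 2" unfolding start_time_eq_choose Suc_choose_two by simp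
  have comparable: "tito_le n (stair_order n t) (stair_order n u)
      \<or> tito_le n (stair_order n u) (stair_order n t)" for t u
    using stair_order_le[OF n] by (meson linear)
  have "is_max_chain_length (CTam n) (tito_le n) ((n + 1) choose 2)"
  proof (rule is_max_chain_lengthI)
    show "pred_on.chain (CTam n) (tito_le n) (stair_order n ` {..start_time n n + n})"
      using stair_order_CTam[OF n] comparable by (auto simp: tito_chain_iff)
    show "card (stair_order n ` {..start_time n n + n}) = ((n + 1) choose 2) + 1"
      using card_image[OF stair_order_inj[OF n]] N by simp
    fix C assume "pred_on.chain (CTam n) (tito_le n) C"
    then show "finite C \<and> card C \<le> ((n + 1) choose 2) + 1"
      unfolding tito_chain_iff using CTam_chain_bound[OF n] by blast
  qed
  moreover have "is_max_chain_length (ATam n) (tito_le n) (((n + 1) choose 2) - 1)"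
  proof (rule is_max_chain_lengthI)
    let ?T = "{..start_time n n + n} - {start_time n n + 1}"
    show "pred_on.chain (ATam n) (tito_le n) (stair_order n ` ?T)"
      using stair_order_real[OF assms] comparable by (auto simp: tito_chain_iff)
    have "card (stair_order n ` ?T) = card ?T"
      by (rule card_image) (rule inj_on_subset[OF stair_order_inj[OF n]], simp)
    also have "\<dots> = start_time n n + n" using n by (simp add: card_Diff_singleton)
    finally show "card (stair_order n ` ?T) = (((n + 1) choose 2) - 1) + 1" using N n by simp
    fix C assume "pred_on.chain (ATam n) (tito_le n) C"
    then show "finite C \<and> card C \<le> (((n + 1) choose 2) - 1) + 1"
      unfolding tito_chain_iff using ATam_chain_bound[OF n] by blast
  qed
  ultimately show ?thesis ..
qed

end
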